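(* Let $z\in\Omega'$ and let $k>0$ be known. Suppose the values of the data $$D_{z}(\lambda)=\gamma(z)|\nabla u(z)|^{2}\,\frac{\left(\frac{\tilde{\gamma}}{\gamma}(z)\,\lambda-1\right)^2}{\frac{\tilde{\gamma}}{\gamma}(z)\,\lambda+1}-k^{2}q(z)|u(z)|^{2}\left(\frac{\tilde{q}}{q}(z)\,\lambda-1\right)$$ are known for four distinct values of the amplitude $\lambda>0$, chosen independently of $\gamma$ and $q$, while the ratios $\frac{\tilde\gamma}{\gamma}(z)>0$ and $\frac{\tilde q}{q}(z)>0$ are unknown. Then one can recover $\gamma(z)|\nabla u(z)|^{2}$ and $q(z)|u(z)|^{2}$; that is, these two quantities are uniquely determined by the four values of $D_z$.
   Context: $\Omega\subset\mathbb{R}^n$ is a smooth bounded domain with boundary $\partial\Omega$ and outward unit normal $\nu$, and $\Omega'=\{x\in\Omega : \operatorname{dist}(x,\partial\Omega)\ge d_0\}$ for some $d_0>0$. The conductivity $\gamma\in C^1(\Omega)$ and the permittivity $q\in C^0(\Omega)$ are real-valued with $0<c_0<\gamma(x),q(x)<C_0$. The frequency $k>0$ is such that $k^2$ is not an eigenvalue of the generalized problem $-\operatorname{div}(\gamma\nabla v)=\mu q v$ in $\Omega$, $\gamma\frac{\partial v}{\partial\nu}=0$ on $\partial\Omega$. The complex-valued function $u\in H^1(\Omega)$ is the unique solution of $\operatorname{div}(\gamma\nabla u)+k^2qu=0$ in $\Omega$, $\gamma\frac{\partial u}{\partial\nu}=\varphi$ on $\partial\Omega$, for a given complex-valued boundary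 datum $\varphi$. An ultrasonic perturbation of known amplitude $\lambda$ (a ratio of perturbed to unperturbed volume, hence positive) localized near $z$ changes $\gamma$ and $q$ locally into $\lambda\tilde\gamma$ and $\lambda\tilde q$ respectively, where $\tilde\gamma,\tilde q$ are positive bounded real-valued functions that do not depend on $\lambda$. The data $D_z(\lambda)$ at the fixed point $z$ is the function of $\lambda$ given by the displayed formula in the claim; the numbers $\gamma(z)|\nabla u(z)|^2$, $q(z)|u(z)|^2$, $\frac{\tilde\gamma}{\gamma}(z)$ and $\frac{\tilde q}{q}(z)$ do not depend on $\lambda$. *)

theory Defs
  imports "HOL-Analysis.Analysis"
begin

primrec C_k_on :: "nat \<Rightarrow> ('a::real_normed_vector \<Rightarrow> 'b::real_normed_vector) \<Rightarrow> 'a set \<Rightarrow> bool" where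
  "C_k_on 0 f S \<longleftrightarrow> continuous_on S f"
| "C_k_on (Suc k) f S \<longleftrightarrow>
     (\<forall>x\<in>S. f differentiable (at x)) \<and>
     (\<forall>v. C_k_on k (\<lambda>x. frechet_derivative f (at x) v) S)"

definition smooth_on :: "('a::real_normed_vector \<Rightarrow> 'b::real_normed_vector) \<Rightarrow> 'a set \<Rightarrow> bool" where
  "smooth_on f S \<longleftrightarrow> (\<forall>k. C_k_on k f S)"

text \<open>Near each boundary point the domain is a strict sublevel set of a smooth function
  without critical point there, so it lies locally on one side of a smooth hypersurface.\<close>

definition smooth_bounded_domain :: "(real^'n) set \<Rightarrow> bool" where
  "smooth_bounded_domain \<Omega> \<longleftrightarrow>
     open \<Omega> \<and> connected \<Omega> \<and> \<Omega> \<noteq> {} \<and> bounded \<Omega> \<and>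
     (\<forall>p\<in>frontier \<Omega>. \<exists>U \<rho>. open U \<and> p \<in> U \<and> smooth_on (\<rho> :: real^'n \<Rightarrow> real) U \<and>
        frechet_derivative \<rho> (at p) \<noteq> (\<lambda>_. 0) \<and> \<Omega> \<inter> U = {x \<in> U. \<rho> x < 0})"

definition inner_region :: "(real^'n) set \<Rightarrow> real \<Rightarrow> (real^'n) set" where
  "inner_region \<Omega> d\<^sub>0 = {x \<in> \<Omega>. infdist x (frontier \<Omega>) \<ge> d\<^sub>0}"

definition cgrad :: "(real^'n \<Rightarrow> complex) \<Rightarrow> real^'n \<Rightarrow> complex^'n" where
  "cgrad u x = (\<chi> i. frechet_derivative u (at x) (axis i 1))"

definition square_integrable_on :: "('a::euclidean_space \<Rightarrow> 'b::real_normed_vector) \<Rightarrow> 'a set \<Rightarrow> bool" where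
  "square_integrable_on f \<Omega> \<longleftrightarrow>
     f \<in> borel_measurable (lebesgue_on \<Omega>) \<and> integrable (lebesgue_on \<Omega>) (\<lambda>x. (norm (f x))\<^sup>2)"

definition test_function :: "(real^'n) set \<Rightarrow> (real^'n \<Rightarrow> complex) \<Rightarrow> bool" where
  "test_function \<Omega> \<psi> \<longleftrightarrow>
     smooth_on \<psi> UNIV \<and> compact (closure {x. \<psi> x \<noteq> 0}) \<and> closure {x. \<psi> x \<noteq> 0} \<subseteq> \<Omega>"

text \<open>\<open>H1_with_grad \<Omega> v G\<close>: the function \<open>v\<close> lies in \<open>H\<^sup>1(\<Omega>)\<close> and \<open>G\<close> is its weak gradient.
  Functions are representatives; values outside \<open>\<Omega>\<close> and on null sets are irrelevant.\<close>

definition H1_with_grad :: "(real^'n) set \<Rightarrow> (real^'n \<Rightarrow> complex) \<Rightarrow> (real^'n \<Rightarrow> complex^'n) \<Rightarrow> bool" where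
  "H1_with_grad \<Omega> v G \<longleftrightarrow>
     square_integrable_on v \<Omega> \<and> square_integrable_on G \<Omega> \<and>
     (\<forall>\<psi> i. test_function \<Omega> \<psi> \<longrightarrow>
        integral\<^sup>L (lebesgue_on \<Omega>) (\<lambda>x. v x * cgrad \<psi> x $ i) =
        - integral\<^sup>L (lebesgue_on \<Omega>) (\<lambda>x. G x $ i * \<psi> x))"

definition H1 :: "(real^'n) set \<Rightarrow> (real^'n \<Rightarrow> complex) set" where
  "H1 \<Omega> = {v. \<exists>G. H1_with_grad \<Omega> v G}"

definition H1_norm :: "(real^'n) set \<Rightarrow> (real^'n \<Rightarrow> complex) \<Rightarrow> (real^'n \<Rightarrow> complex^'n) \<Rightarrow> real" where
  "H1_norm \<Omega> v G = sqrt (integral\<^sup>L (lebesgue_on \<Omega>) (\<lambda>x. (norm (v x))\<^sup>2 + (norm (G x))\<^sup>2))"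

definition H1_0 :: "(real^'n) set \<Rightarrow> (real^'n \<Rightarrow> complex) set" where
  "H1_0 \<Omega> = {v. \<exists>G. H1_with_grad \<Omega> v G \<and>
     (\<forall>\<epsilon>>0. \<exists>\<psi>. test_function \<Omega> \<psi> \<and>
        H1_norm \<Omega> (\<lambda>x. v x - \<psi> x) (\<lambda>x. G x - cgrad \<psi> x) < \<epsilon>)}"

text \<open>Neumann data for \<open>H\<^sup>1\<close> solutions live in \<open>H\<^sup>-\<^sup>1\<^sup>/\<^sup>2(\<partial>\<Omega>)\<close>.  As the trace operator identifies
  \<open>H\<^sup>1\<^sup>/\<^sup>2(\<partial>\<Omega>)\<close> with \<open>H\<^sup>1(\<Omega>)/H\<^sup>1\<^sub>0(\<Omega>)\<close>, such a datum is a bounded complex-linear functional on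
  \<open>H\<^sup>1(\<Omega>)\<close> that vanishes on \<open>H\<^sup>1\<^sub>0(\<Omega>)\<close>.  A function \<open>\<phi>\<close> on the boundary is the functional taking
  \<open>v\<close> to the surface integral of \<open>\<phi> v\<close>.\<close>

definition neumann_datum :: "(real^'n) set \<Rightarrow> ((real^'n \<Rightarrow> complex) \<Rightarrow> complex) \<Rightarrow> bool" where
  "neumann_datum \<Omega> \<phi> \<longleftrightarrow>
     (\<forall>v\<in>H1 \<Omega>. \<forall>w\<in>H1 \<Omega>. \<phi> (\<lambda>x. v x + w x) = \<phi> v + \<phi> w) \<and>
     (\<forall>v\<in>H1 \<Omega>. \<forall>a. \<phi> (\<lambda>x. a * v x) = a * \<phi> v) \<and>
     (\<exists>M. \<forall>v G. H1_with_grad \<Omega> v G \<longrightarrow> norm (\<phi> v) \<le> M * H1_norm \<Omega> v G) \<and>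
     (\<forall>v\<in>H1_0 \<Omega>. \<phi> v = 0)"

text \<open>Weak form of \<open>div (\<gamma> \<nabla>u) + \<mu> q u = 0\<close> in \<open>\<Omega>\<close>, \<open>\<gamma> \<partial>u/\<partial>\<nu> = \<phi>\<close> on \<open>\<partial>\<Omega>\<close>, with
  \<open>u \<in> H\<^sup>1(\<Omega>)\<close>: Green's formula defines the conormal derivative for the outward normal \<open>\<nu>\<close>.\<close>

definition neumann_solution ::
  "(real^'n) set \<Rightarrow> (real^'n \<Rightarrow> real) \<Rightarrow> (real^'n \<Rightarrow> real) \<Rightarrow> real \<Rightarrow>
   ((real^'n \<Rightarrow> complex) \<Rightarrow> complex) \<Rightarrow> (real^'n \<Rightarrow> complex) \<Rightarrow> bool" where
  "neumann_solution \<Omega> \<gamma> q \<mu> \<phi> u \<longleftrightarrow>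
     (\<exists>G. H1_with_grad \<Omega> u G \<and>
       (\<forall>v H. H1_with_grad \<Omega> v H \<longrightarrow>
          integral\<^sup>L (lebesgue_on \<Omega>) (\<lambda>x. of_real (\<gamma> x) * (\<Sum>i\<in>UNIV. G x $ i * H x $ i))
          - of_real \<mu> * integral\<^sup>L (lebesgue_on \<Omega>) (\<lambda>x. of_real (q x) * u x * v x) = \<phi> v))"

definition neumann_eigenvalue ::
  "(real^'n) set \<Rightarrow> (real^'n \<Rightarrow> real) \<Rightarrow> (real^'n \<Rightarrow> real) \<Rightarrow> real \<Rightarrow> bool" where
  "neumann_eigenvalue \<Omega> \<gamma> q \<mu> \<longleftrightarrow>
     (\<exists>v. neumann_solution \<Omega> \<gamma> q \<mu> (\<lambda>_. 0) v \<and> \<not> (AE x in lebesgue_on \<Omega>. v x = 0))"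

text \<open>Since \<open>k\<^sup>2\<close> is not an eigenvalue, \<open>u\<close> is the unique solution up to null sets.  The clause
  \<open>C_k_on 1 u \<Omega>\<close> selects its continuously differentiable representative, which exists by interior
  regularity; point values of \<open>u\<close> and \<open>\<nabla>u\<close> refer to it.\<close>

definition medium_with_field ::
  "(real^'n) set \<Rightarrow> real \<Rightarrow> real \<Rightarrow> real \<Rightarrow> ((real^'n \<Rightarrow> complex) \<Rightarrow> complex) \<Rightarrow>
   (real^'n \<Rightarrow> real) \<Rightarrow> (real^'n \<Rightarrow> real) \<Rightarrow> (real^'n \<Rightarrow> complex) \<Rightarrow> bool" where
  "medium_with_field \<Omega> c\<^sub>0 C\<^sub>0 k \<phi> \<gamma> q u \<longleftrightarrow>
     C_k_on 1 \<gamma> \<Omega> \<and> continuous_on \<Omega> q \<and>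
     (\<forall>x\<in>\<Omega>. c\<^sub>0 < \<gamma> x \<and> \<gamma> x < C\<^sub>0 \<and> c\<^sub>0 < q x \<and> q x < C\<^sub>0) \<and>
     \<not> neumann_eigenvalue \<Omega> \<gamma> q (k\<^sup>2) \<and>
     neumann_datum \<Omega> \<phi> \<and> neumann_solution \<Omega> \<gamma> q (k\<^sup>2) \<phi> u \<and> C_k_on 1 u \<Omega>"

definition perturbation_profile :: "(real^'n) set \<Rightarrow> (real^'n \<Rightarrow> real) \<Rightarrow> bool" where
  "perturbation_profile \<Omega> f \<longleftrightarrow> (\<forall>x\<in>\<Omega>. 0 < f x) \<and> bounded (f ` \<Omega>)"

definition gradient_energy :: "(real^'n \<Rightarrow> real) \<Rightarrow> (real^'n \<Rightarrow> complex) \<Rightarrow> real^'n \<Rightarrow> real" where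
  "gradient_energy \<gamma> u z = \<gamma> z * (norm (cgrad u z))\<^sup>2"

definition potential_energy :: "(real^'n \<Rightarrow> real) \<Rightarrow> (real^'n \<Rightarrow> complex) \<Rightarrow> real^'n \<Rightarrow> real" where
  "potential_energy q u z = q z * (norm (u z))\<^sup>2"

definition ultrasound_data ::
  "real \<Rightarrow> (real^'n \<Rightarrow> real) \<Rightarrow> (real^'n \<Rightarrow> real) \<Rightarrow> (real^'n \<Rightarrow> real) \<Rightarrow> (real^'n \<Rightarrow> real) \<Rightarrow>
   (real^'n \<Rightarrow> complex) \<Rightarrow> real^'n \<Rightarrow> real \<Rightarrow> real" where
  "ultrasound_data k \<gamma> q \<gamma>t qt u z lam =
     gradient_energy \<gamma> u z * ((\<gamma>t z / \<gamma> z * lam - 1)\<^sup>2 / (\<gamma>t z / \<gamma> z * lam + 1))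
     - k\<^sup>2 * potential_energy q u z * (qt z / q z * lam - 1)"

end

theory Submission
  imports Defs "HOL-Computational_Algebra.Polynomial"
begin

text \<open>The claim is a statement about rational functions of the amplitude at the fixed point \<open>z\<close>. Write \<open>E\<close> for the gradient energy, \<open>P\<close> for the potential energy
  and \<open>a, b > 0\<close> for the two unknown ratios. Dividing out the fraction gives
  \<open>(x - 1)\<^sup>2 / (x + 1) = x - 3 + 4 / (x + 1)\<close>, so that the data are, as a function of the amplitude,
  \<open>(a E - k\<^sup>2 b P) lam + (k\<^sup>2 P - 3 E) + 4 E / (a lam + 1)\<close>,
  an affine part plus one simple pole at \<open>-1/a < 0\<close>.

  The difference of two such functions, multiplied by both denominators, is a polynomial of degree at
  most three. Four zeros make it vanish identically, which forces the two affine parts and the two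
  numerators to agree (lemma \<open>affine_plus_pole_unique\<close>). The numerators give \<open>E\<close>, and then the
  constant terms \<open>k\<^sup>2 P - 3 E\<close> give \<open>P\<close> since \<open>k \<noteq> 0\<close>. The ratios themselves cannot always
  be recovered: if \<open>E = 0\<close>, the number \<open>a\<close> leaves no trace in the data, and if \<open>P = 0\<close>, neither does \<open>b\<close>.\<close>

text \<open>The two poles may coincide; comparing coefficients of the cubic, instead of residues, treats
  this case together with the generic one. It works from the top: the leading coefficient is
  \<open>a\<^sub>1 a\<^sub>2\<close> times the difference of the slopes, and once that difference is zero the next coefficient is
  \<open>a\<^sub>1 a\<^sub>2\<close> times the difference of the intercepts.\<close>

lemma affine_plus_pole_unique:
  fixes a\<^sub>1 a\<^sub>2 s\<^sub>1 s\<^sub>2 t\<^sub>1 t\<^sub>2 e\<^sub>1 e\<^sub>2 :: "'a::field" and \<Lambda> :: "'a set"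
  assumes a: "a\<^sub>1 \<noteq> 0" "a\<^sub>2 \<noteq> 0"
    and card: "card \<Lambda> > 3"
    and off_poles: "\<And>x. x \<in> \<Lambda> \<Longrightarrow> a\<^sub>1 * x + 1 \<noteq> 0 \<and> a\<^sub>2 * x + 1 \<noteq> 0"
    and eq: "\<And>x. x \<in> \<Lambda> \<Longrightarrow> s\<^sub>1 * x + t\<^sub>1 + e\<^sub>1 / (a\<^sub>1 * x + 1) = s\<^sub>2 * x + t\<^sub>2 + e\<^sub>2 / (a\<^sub>2 * x + 1)"
  shows "s\<^sub>1 = s\<^sub>2" and "t\<^sub>1 = t\<^sub>2" and "e\<^sub>1 = e\<^sub>2"
proof -
  define s t where "s = s\<^sub>1 - s\<^sub>2" and "t = t\<^sub>1 - t\<^sub>2"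
  define p where
    "p = [: t + e\<^sub>1 - e\<^sub>2, s + t * (a\<^sub>1 + a\<^sub>2) + e\<^sub>1 * a\<^sub>2 - e\<^sub>2 * a\<^sub>1, s * (a\<^sub>1 + a\<^sub>2) + t * a\<^sub>1 * a\<^sub>2, s * a\<^sub>1 * a\<^sub>2 :]"
  have root: "poly p x = 0" if "x \<in> \<Lambda>" for x
  proof -
    define A B where "A = a\<^sub>1 * x + 1" and "B = a\<^sub>2 * x + 1"
    have AB: "A \<noteq> 0" "B \<noteq> 0"
      using off_poles[OF that] by (auto simp: A_def B_def)
    have "poly p x = (s * x + t) * A * B + e\<^sub>1 * B - e\<^sub>2 * A"
      by (simp add: p_def A_def B_def algebra_simps)
    also have "\<dots> = ((s * x + t) + e\<^sub>1 / A - e\<^sub>2 / B) * (A * B)"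
      using AB by (simp add: field_simps)
    also have "(s * x + t) + e\<^sub>1 / A - e\<^sub>2 / B = 0"
      using eq[OF that] by (simp add: s_def t_def A_def B_def algebra_simps)
    finally show ?thesis by simp
  qed
  have "p = 0"
  proof (rule ccontr)
    assume "p \<noteq> 0"
    have "card \<Lambda> \<le> card {x. poly p x = 0}"
      using root by (intro card_mono poly_roots_finite \<open>p \<noteq> 0\<close>) auto
    also have "\<dots> \<le> degree p"
      by (rule card_poly_roots_bound) fact
    also have "\<dots> \<le> 3"
      by (simp add: p_def)
    finally show False using card by simp
  qed
  then have coeffs: "t + e\<^sub>1 - e\<^sub>2 = 0" "s * (a\<^sub>1 + a\<^sub>2) + t * a\<^sub>1 * a\<^sub>2 = 0" "s * a\<^sub>1 * a\<^sub>2 = 0"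
    by (simp_all add: p_def)
  from coeffs(3) a have "s = 0" by simp
  with coeffs(2) a have "t = 0" by simp
  show "s\<^sub>1 = s\<^sub>2" "t\<^sub>1 = t\<^sub>2" "e\<^sub>1 = e\<^sub>2"
    using \<open>s = 0\<close> \<open>t = 0\<close> coeffs(1) by (simp_all add: s_def t_def)
qed

lemma ultrasound_data_partial_fractions:
  assumes "\<gamma>t z / \<gamma> z * lam + 1 \<noteq> 0"
  shows "ultrasound_data k \<gamma> q \<gamma>t qt u z lam =
     (gradient_energy \<gamma> u z * (\<gamma>t z / \<gamma> z) - k\<^sup>2 * potential_energy q u z * (qt z / q z)) * lam
     + (k\<^sup>2 * potential_energy q u z - 3 * gradient_energy \<gamma> u z)
     + 4 * gradient_energy \<gamma> u z / (\<gamma>t z / \<gamma> z * lam + 1)"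
proof -
  have "(x - 1)\<^sup>2 / (x + 1) = x - 3 + 4 / (x + 1)" if "x + 1 \<noteq> 0" for x :: real
    using that by (simp add: field_simps power2_eq_square)
  from this[OF assms] show ?thesis
    unfolding ultrasound_data_def by (simp only:) (simp add: algebra_simps)
qed

theorem lemma1p1:
  fixes \<Omega> :: "(real^'n) set" and d\<^sub>0 c\<^sub>0 C\<^sub>0 k :: real and z :: "real^'n" and \<Lambda> :: "real set"
    and \<phi>\<^sub>1 \<phi>\<^sub>2 :: "(real^'n \<Rightarrow> complex) \<Rightarrow> complex"
    and \<gamma>\<^sub>1 q\<^sub>1 \<gamma>t\<^sub>1 qt\<^sub>1 \<gamma>\<^sub>2 q\<^sub>2 \<gamma>t\<^sub>2 qt\<^sub>2 :: "real^'n \<Rightarrow> real"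
    and u\<^sub>1 u\<^sub>2 :: "real^'n \<Rightarrow> complex"
  assumes "smooth_bounded_domain \<Omega>"
    and "0 < d\<^sub>0" and "z \<in> inner_region \<Omega> d\<^sub>0"
    and "0 < c\<^sub>0" and "0 < k"
    and "card \<Lambda> = 4" and "\<forall>lam\<in>\<Lambda>. 0 < lam"
    and "medium_with_field \<Omega> c\<^sub>0 C\<^sub>0 k \<phi>\<^sub>1 \<gamma>\<^sub>1 q\<^sub>1 u\<^sub>1"
    and "perturbation_profile \<Omega> \<gamma>t\<^sub>1" and "perturbation_profile \<Omega> qt\<^sub>1"
    and "medium_with_field \<Omega> c\<^sub>0 C\<^sub>0 k \<phi>\<^sub>2 \<gamma>\<^sub>2 q\<^sub>2 u\<^sub>2"
    and "perturbation_profile \<Omega> \<gamma>t\<^sub>2" and "perturbation_profile \<Omega> qt\<^sub>2"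
    and "\<forall>lam\<in>\<Lambda>. ultrasound_data k \<gamma>\<^sub>1 q\<^sub>1 \<gamma>t\<^sub>1 qt\<^sub>1 u\<^sub>1 z lam = ultrasound_data k \<gamma>\<^sub>2 q\<^sub>2 \<gamma>t\<^sub>2 qt\<^sub>2 u\<^sub>2 z lam"
  shows "gradient_energy \<gamma>\<^sub>1 u\<^sub>1 z = gradient_energy \<gamma>\<^sub>2 u\<^sub>2 z \<and>
         potential_energy q\<^sub>1 u\<^sub>1 z = potential_energy q\<^sub>2 u\<^sub>2 z"
proof -
  have z: "z \<in> \<Omega>"
    using assms(3) by (simp add: inner_region_def)
  define a\<^sub>1 a\<^sub>2 where "a\<^sub>1 = \<gamma>t\<^sub>1 z / \<gamma>\<^sub>1 z" and "a\<^sub>2 = \<gamma>t\<^sub>2 z / \<gamma>\<^sub>2 z"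
  have "0 < \<gamma>\<^sub>1 z" "0 < \<gamma>\<^sub>2 z"
    using assms(4,8,11) z unfolding medium_with_field_def by force+
  moreover have "0 < \<gamma>t\<^sub>1 z" "0 < \<gamma>t\<^sub>2 z"
    using assms(9,12) z by (auto simp: perturbation_profile_def)
  ultimately have a: "0 < a\<^sub>1" "0 < a\<^sub>2"
    by (simp_all add: a\<^sub>1_def a\<^sub>2_def)
  have off_poles: "a\<^sub>1 * lam + 1 \<noteq> 0 \<and> a\<^sub>2 * lam + 1 \<noteq> 0" if "lam \<in> \<Lambda>" for lam
  proof -
    have "0 < a\<^sub>1 * lam" "0 < a\<^sub>2 * lam"
      using a assms(7) that by auto
    then show ?thesis by linarith
  qed
  let ?s = "\<lambda>\<gamma> q qt u a. gradient_energy \<gamma> u z * a - k\<^sup>2 * potential_energy q u z * (qt z / q z)"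
  let ?t = "\<lambda>\<gamma> q u. k\<^sup>2 * potential_energy q u z - 3 * gradient_energy \<gamma> u z"
  have eq: "?s \<gamma>\<^sub>1 q\<^sub>1 qt\<^sub>1 u\<^sub>1 a\<^sub>1 * lam + ?t \<gamma>\<^sub>1 q\<^sub>1 u\<^sub>1 + 4 * gradient_energy \<gamma>\<^sub>1 u\<^sub>1 z / (a\<^sub>1 * lam + 1)
          = ?s \<gamma>\<^sub>2 q\<^sub>2 qt\<^sub>2 u\<^sub>2 a\<^sub>2 * lam + ?t \<gamma>\<^sub>2 q\<^sub>2 u\<^sub>2 + 4 * gradient_energy \<gamma>\<^sub>2 u\<^sub>2 z / (a\<^sub>2 * lam + 1)"
    if "lam \<in> \<Lambda>" for lam
    using assms(14) that off_poles[OF that]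
      ultrasound_data_partial_fractions[of \<gamma>t\<^sub>1 z \<gamma>\<^sub>1 lam k q\<^sub>1 qt\<^sub>1 u\<^sub>1]
      ultrasound_data_partial_fractions[of \<gamma>t\<^sub>2 z \<gamma>\<^sub>2 lam k q\<^sub>2 qt\<^sub>2 u\<^sub>2]
    unfolding a\<^sub>1_def a\<^sub>2_def by metis
  have "a\<^sub>1 \<noteq> 0" "a\<^sub>2 \<noteq> 0" "card \<Lambda> > 3"
    using a assms(6) by auto
  note unique = affine_plus_pole_unique[OF this off_poles eq]
  have "gradient_energy \<gamma>\<^sub>1 u\<^sub>1 z = gradient_energy \<gamma>\<^sub>2 u\<^sub>2 z"
    using unique(3) by simp
  moreover from this have "potential_energy q\<^sub>1 u\<^sub>1 z = potential_energy q\<^sub>2 u\<^sub>2 z"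
    using unique(2) assms(5) by simp
  ultimately show ?thesis ..
qed

end
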